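(* Let $T$ be a tree and let $l\colon V(T)\to[0,\infty)$ be a non-degenerate labeling. Then the following are equivalent: (1) the ultrametric space $(V(T), d_l)$ is discrete; (2) for every $v^*\in V(T)$ either $l(v^* )>0$, or $l(v^* )=0$ and $0<\inf_{u\in V(N(v^* ))} l(u)$, where $N(v^* )$ is the neighborhood of $v^*$ in $T$ (with the convention $\inf\varnothing=+\infty$).
   Context: A tree is a connected acyclic graph with nonempty vertex set. The neighborhood $N(v)$ of a vertex $v$ is the subgraph induced by all vertices adjacent to $v$. For a labeling $l\colon V(T)\to[0,\infty)$ define $d_l(u,u)=0$ and, for $u\neq v$, $d_l(u,v)=\max_{w\in V(P)} l(w)$, where $P$ is the unique path joining $u$ and $v$ in $T$. The labeling is non-degenerate if $\max\{l(u),l(v)\}>0$ for every edge $\{u,v\}$; then $d_l$ is an ultrametric. A metric space is discrete if all its points are isolated. *)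

theory Defs
  imports "HOL-Analysis.Analysis" "Graph_Theory.Digraph_Component_Vwalk"
begin

text \<open>
  A simple undirected graph, possibly infinite, is a loop-free symmetric digraph without
  parallel arcs (locale \<^locale>\<open>pair_bidirected_digraph\<close>): the edge joining u and v is the pair of
  arcs (u,v), (v,u).  The constant \<open>tree\<close> of the digraph library cannot be used, because there
  a, b, a counts as a directed cycle.  Cycles are therefore given here by their vertices in cyclic
  order, of which there must be at least three.
\<close>

definition undirected_cycle :: "'a list \<Rightarrow> 'a pair_pre_digraph \<Rightarrow> bool" where
  "undirected_cycle c G \<longleftrightarrow> vpath c (with_proj G) \<and> 3 \<le> length c \<and> (last c, hd c) \<in> parcs G"

text \<open>Nonemptiness of the vertex set is part of \<^const>\<open>Digraph_Component.connected\<close>.\<close>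

definition undirected_tree :: "'a pair_pre_digraph \<Rightarrow> bool" where
  "undirected_tree T \<longleftrightarrow>
     pair_bidirected_digraph T \<and> Digraph_Component.connected (with_proj T) \<and>
     (\<nexists>c. undirected_cycle c T)"

definition neighborhood :: "'a pair_pre_digraph \<Rightarrow> 'a \<Rightarrow> ('a, 'a \<times> 'a) pre_digraph" where
  "neighborhood G v = with_proj G \<restriction> {u \<in> pverts G. (v, u) \<in> parcs G}"

definition labeling :: "'a pair_pre_digraph \<Rightarrow> ('a \<Rightarrow> real) \<Rightarrow> bool" where
  "labeling T l \<longleftrightarrow> (\<forall>v\<in>pverts T. 0 \<le> l v)"

definition nondegenerate :: "'a pair_pre_digraph \<Rightarrow> ('a \<Rightarrow> real) \<Rightarrow> bool" where
  "nondegenerate T l \<longleftrightarrow> (\<forall>(u, v)\<in>parcs T. 0 < max (l u) (l v))"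

definition joining_path :: "'a pair_pre_digraph \<Rightarrow> 'a \<Rightarrow> 'a \<Rightarrow> 'a list" where
  "joining_path T u v = (THE p. vpath p (with_proj T) \<and> hd p = u \<and> last p = v)"

text \<open>
  The value 0 outside the vertex set is a dummy: \<^locale>\<open>Metric_space\<close> asks for nonnegativity and
  symmetry on the whole type.
\<close>

definition tree_dist :: "'a pair_pre_digraph \<Rightarrow> ('a \<Rightarrow> real) \<Rightarrow> 'a \<Rightarrow> 'a \<Rightarrow> real" where
  "tree_dist T l u v =
     (if u \<in> pverts T \<and> v \<in> pverts T \<and> u \<noteq> v then Max (l ` set (joining_path T u v)) else 0)"

definition discrete_metric_space :: "'a set \<Rightarrow> ('a \<Rightarrow> 'a \<Rightarrow> real) \<Rightarrow> bool" where
  "discrete_metric_space M d \<longleftrightarrow> (\<forall>x\<in>M. openin (Metric_space.mtopology M d) {x})"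

end

theory Submission
  imports Defs
begin

text \<open>
  In a tree the joining path of two vertices is contained in every walk between them. Hence
  \<open>d\<^sub>l(u, w)\<close> is at most the maximum of \<open>l\<close> over the concatenation of the paths from \<open>u\<close> to \<open>v\<close> and
  from \<open>v\<close> to \<open>w\<close>, which is the strong triangle inequality. Moreover every path leaving \<open>v\<close> passes
  through a neighbor of \<open>v\<close>, so the distance from \<open>v\<close> to the other points is bounded below both by
  \<open>l(v)\<close> and by the infimum of \<open>l\<close> over the neighbors; and if \<open>l(v) = 0\<close>, a neighbor \<open>u\<close> lies at
  distance exactly \<open>l(u)\<close>.
\<close>

lemma (in pair_sym_digraph) vwalk_rev:
  assumes "vwalk p (with_proj G)"
  shows "vwalk (rev p) (with_proj G)"
  using assms by (auto simp: vwalk_def set_vwalk_arcs_rev intro: arcs_symmetric)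

locale simple_tree = pair_bidirected_digraph T
  for T :: "'a pair_pre_digraph" +
  assumes undirected_tree: "undirected_tree T"
begin

text \<open>Paths with the same first vertex \<open>x\<close> are compared at their second vertices.
  If these agree, induction applies to the tails. If they differ, following one tail to the common
  end and the other one back gives a walk between them that avoids \<open>x\<close>; shortened to a
  path, it closes up through \<open>x\<close> to a cycle.\<close>

lemma vpath_unique:
  assumes "vpath p (with_proj T)" "vpath q (with_proj T)" "hd p = hd q" "last p = last q"
  shows "p = q"
  using assms
proof (induction p arbitrary: q)
  case Nil
  then show ?case by auto
next
  case (Cons x p)
  then obtain q' where q: "q = x # q'"
    by (cases q) (auto simp: vpath_def vwalk_def)
  have x: "x \<notin> set p" "x \<notin> set q'"
    using Cons.prems q by (auto simp: vpath_def)
  show ?case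
  proof (cases "p = [] \<or> q' = []")
    case True
    \<comment> \<open>If one tail is empty, the common last vertex is \<open>x\<close>, which lies
      in neither tail, so the other tail is empty too.\<close>
    then show ?thesis
      using Cons.prems(4) x unfolding q by (metis last_ConsL last_ConsR last_in_set)
  next
    case False
    have p': "vpath p (with_proj T)" "(x, hd p) \<in> parcs T"
      using Cons.prems(1) False by (auto simp: vpath_def elim!: vwalk_consE)
    have q'': "vpath q' (with_proj T)" "(x, hd q') \<in> parcs T"
      using Cons.prems(2) False unfolding q by (auto simp: vpath_def elim!: vwalk_consE)
    have last: "last p = last q'"
      using Cons.prems(4) False q by simp
    show ?thesis
    proof (cases "hd p = hd q'")
      case True
      then show ?thesis
        using Cons.IH p'(1) q''(1) last q by blast
    next
      case neq: False
      define w where "w = p \<oplus> rev q'"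
      define r where "r = vwalk_to_vpath w"
      have joinable: "joinable p (rev q')"
        using False last by (simp add: hd_rev)
      have "vwalk w (with_proj T)"
        unfolding w_def using p'(1) q''(1) joinable
        by (intro vwalk_joinI_vwalk vwalk_rev) (auto simp: vpath_def)
      then have r: "vpath r (with_proj T)"
        unfolding r_def by (rule vwalk_to_vpath_vpath)
      have "set w \<subseteq> set p \<union> set q'"
        unfolding w_def vwalk_join_def using list.set_sel(2)[of "rev q'"] False by auto
      then have "x \<notin> set r"
        using x vwalk_to_vpath_subset[of x w] unfolding r_def by blast
      have hd_r: "hd r = hd p"
        unfolding r_def vwalk_to_vpath_hd w_def using vwalk_join_hd[OF joinable] .
      have last_r: "last r = hd q'"
        unfolding r_def vwalk_to_vpath_last w_def
        using vwalk_join_last[OF joinable] False by (simp add: last_rev)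
      \<comment> \<open>The ends of \<open>r\<close> differ, so together with \<open>x\<close> there
        are the three vertices that a cycle requires.\<close>
      have "2 \<le> length r"
        using neq hd_r last_r r by (cases r; cases "tl r") (auto simp: vpath_def vwalk_def)
      moreover have "vwalk (x # r) (with_proj T)"
        using r p'(2) hd_r by (intro vwalk_consI) (auto simp: vpath_def dest: in_arcsD1)
      ultimately have "undirected_cycle (x # r) T"
        using r \<open>x \<notin> set r\<close> last_r arcs_symmetric[OF q''(2)]
        by (auto simp: undirected_cycle_def vpath_def)
      then show ?thesis
        using undirected_tree by (auto simp: undirected_tree_def)
    qed
  qed
qed

lemma joining_path_eq:
  assumes "vpath p (with_proj T)"
  shows "joining_path T (hd p) (last p) = p"
  unfolding joining_path_def using assms by (intro the_equality) (auto intro: vpath_unique)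

lemma joining_path:
  assumes "u \<in> pverts T" "v \<in> pverts T"
  shows "vpath (joining_path T u v) (with_proj T)"
    and "hd (joining_path T u v) = u" and "last (joining_path T u v) = v"
proof -
  \<comment> \<open>Connectedness is strong connectedness of the symmetric closure; as the arcs of
    \<open>T\<close> are symmetric, reachability is the same in both.\<close>
  have "u \<rightarrow>\<^sup>*\<^bsub>with_proj T\<^esub> v"
    using undirected_tree assms reachable_mk_symmetric_eq[OF pair_sym_arcs]
    by (auto simp: undirected_tree_def connected_def strongly_connected_def)
  then obtain p where "vpath p (with_proj T)" "hd p = u" "last p = v"
    by (auto simp: reachable_vpath_conv)
  with joining_path_eq show "vpath (joining_path T u v) (with_proj T)"
    and "hd (joining_path T u v) = u" and "last (joining_path T u v) = v"
    by auto
qed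

text \<open>Shortening a walk to a path keeps the ends and adds no vertices; by uniqueness the
  result is the joining path.\<close>

lemma set_joining_path_subset:
  assumes "vwalk p (with_proj T)"
  shows "set (joining_path T (hd p) (last p)) \<subseteq> set p"
  using joining_path_eq[OF vwalk_to_vpath_vpath[OF assms]] vwalk_to_vpath_subset[of _ p]
  by (auto simp: vwalk_to_vpath_hd vwalk_to_vpath_last)

text \<open>The witness \<open>w\<close> is the second vertex of the path. It serves both for
  positivity of the distance and for the lower bounds around a vertex.\<close>

lemma joining_path_neighbor:
  assumes "u \<in> pverts T" "v \<in> pverts T" "u \<noteq> v"
  obtains w where "(u, w) \<in> parcs T" "{u, w} \<subseteq> set (joining_path T u v)"
proof -
  obtain p where p: "joining_path T u v = u # p" "p \<noteq> []"
    using joining_path[OF assms(1,2)] assms(3)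
    by (cases "joining_path T u v") (auto simp: vpath_def vwalk_def split: if_splits)
  then have "(u, hd p) \<in> parcs T"
    using joining_path(1)[OF assms(1,2)] by (auto simp: vpath_def elim!: vwalk_consE)
  then show thesis
    using p that by auto
qed

lemma set_joining_path_commute:
  assumes "u \<in> pverts T" "v \<in> pverts T"
  shows "set (joining_path T u v) = set (joining_path T v u)"
proof -
  have "set (joining_path T y x) \<subseteq> set (joining_path T x y)"
    if "x \<in> pverts T" "y \<in> pverts T" for x y
    using joining_path[OF that] set_joining_path_subset[of "rev (joining_path T x y)"] vwalk_rev
    by (auto simp: vpath_def hd_rev last_rev)
  then show ?thesis using assms by blast
qed

lemma set_joining_path_triangle:
  assumes "u \<in> pverts T" "v \<in> pverts T" "w \<in> pverts T"
  shows "set (joining_path T u w) \<subseteq> set (joining_path T u v) \<union> set (joining_path T v w)"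
proof -
  let ?p = "joining_path T u v" and ?q = "joining_path T v w"
  note p = joining_path[OF assms(1,2)] and q = joining_path[OF assms(2,3)]
  have joinable: "joinable ?p ?q"
    using p q by (auto simp: joinable_def)
  have "vwalk (?p \<oplus> ?q) (with_proj T)"
    using p q joinable by (intro vwalk_joinI_vwalk) (auto simp: vpath_def)
  from set_joining_path_subset[OF this]
  have "set (joining_path T u w) \<subseteq> set (?p \<oplus> ?q)"
    using p q vwalk_join_hd[OF joinable] vwalk_join_last[OF joinable] by simp
  also have "\<dots> \<subseteq> set ?p \<union> set ?q"
    using joinable list.set_sel(2)[of ?q] by (auto simp: vwalk_join_def joinable_def)
  finally show ?thesis .
qed

lemma label_le_tree_dist:
  assumes "u \<in> pverts T" "v \<in> pverts T" "u \<noteq> v" "w \<in> set (joining_path T u v)"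
  shows "l w \<le> tree_dist T l u v"
  using assms by (simp add: tree_dist_def)

text \<open>The edge is itself the joining path, so the maximum runs over its two ends only.\<close>

lemma tree_dist_edge:
  assumes "(u, v) \<in> parcs T"
  shows "tree_dist T l u v = max (l u) (l v)"
proof -
  have "vpath [u, v] (with_proj T)"
    using assms by (intro vpathI_arc) simp
  from joining_path_eq[OF this] show ?thesis
    using assms no_loops' by (auto simp: tree_dist_def dest: in_arcsD1 in_arcsD2)
qed

lemma tree_dist_commute: "tree_dist T l u v = tree_dist T l v u"
  using set_joining_path_commute by (auto simp: tree_dist_def)

lemma tree_dist_nonneg:
  assumes "labeling T l"
  shows "0 \<le> tree_dist T l u v"
proof (cases "u \<in> pverts T \<and> v \<in> pverts T \<and> u \<noteq> v")
  case True
  then obtain w where "w \<in> set (joining_path T u v)" "w = u"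
    using joining_path_neighbor by blast
  with True assms label_le_tree_dist[of u v w l] show ?thesis
    by (auto simp: labeling_def intro: order_trans)
qed (auto simp: tree_dist_def)

lemma tree_dist_ultrametric:
  assumes "labeling T l" "u \<in> pverts T" "v \<in> pverts T" "w \<in> pverts T"
  shows "tree_dist T l u w \<le> max (tree_dist T l u v) (tree_dist T l v w)"
\<comment> \<open>Coinciding points are treated apart because their distance is 0 by definition, not
  the label of the one-vertex path.\<close>
proof (cases "u = w \<or> u = v \<or> v = w")
  case True
  then show ?thesis
    using tree_dist_nonneg[OF assms(1), of u v] by (auto simp: tree_dist_def le_max_iff_disj)
next
  case False
  have "joining_path T u w \<noteq> []"
    using joining_path(1)[OF assms(2,4)] by auto
  moreover have "l x \<le> max (tree_dist T l u v) (tree_dist T l v w)"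
    if "x \<in> set (joining_path T u w)" for x
    using that set_joining_path_triangle[OF assms(2-4)] label_le_tree_dist[of u v x l]
      label_le_tree_dist[of v w x l] assms False
    by (auto simp: le_max_iff_disj)
  ultimately show ?thesis
    using False assms by (simp add: tree_dist_def[of T l u w])
qed

text \<open>Non-degeneracy is applied to the first edge of the joining path: one of its ends has a
  positive label.\<close>

lemma tree_dist_pos:
  assumes "nondegenerate T l" "u \<in> pverts T" "v \<in> pverts T" "u \<noteq> v"
  shows "0 < tree_dist T l u v"
proof -
  obtain w where w: "(u, w) \<in> parcs T" "{u, w} \<subseteq> set (joining_path T u v)"
    using joining_path_neighbor assms by blast
  then have "max (l u) (l w) \<le> tree_dist T l u v"
    using label_le_tree_dist assms by auto
  moreover have "0 < max (l u) (l w)"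
    using assms(1) w(1) unfolding nondegenerate_def by blast
  ultimately show ?thesis by linarith
qed

lemma Metric_space_tree_dist:
  assumes "labeling T l" "nondegenerate T l"
  shows "Metric_space (pverts T) (tree_dist T l)"
proof
  fix u v w
  assume uvw: "u \<in> pverts T" "v \<in> pverts T"
  show "tree_dist T l u v = 0 \<longleftrightarrow> u = v"
    using tree_dist_pos[OF assms(2) uvw] by (cases "u = v") (auto simp: tree_dist_def)
  assume "w \<in> pverts T"
  \<comment> \<open>The maximum of two nonnegative numbers is at most their sum.\<close>
  with uvw show "tree_dist T l u w \<le> tree_dist T l u v + tree_dist T l v w"
    using tree_dist_ultrametric[OF assms(1), of u v w] tree_dist_nonneg[OF assms(1), of u v]
      tree_dist_nonneg[OF assms(1), of v w] by linarith
qed (use assms(1) tree_dist_nonneg tree_dist_commute in auto)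

lemma isolated_iff:
  assumes "labeling T l" "v \<in> pverts T"
  shows "(\<exists>r>0. \<forall>u\<in>pverts T. u \<noteq> v \<longrightarrow> r \<le> tree_dist T l v u) \<longleftrightarrow>
    0 < l v \<or> (l v = 0 \<and> 0 < (INF u\<in>verts (neighborhood T v). ereal (l u)))"
    (is "?isolated \<longleftrightarrow> 0 < l v \<or> (l v = 0 \<and> 0 < ?inf)")
proof
  assume ?isolated
  then obtain r where r: "r > 0" "\<And>u. u \<in> pverts T \<Longrightarrow> u \<noteq> v \<Longrightarrow> r \<le> tree_dist T l v u"
    by blast
  have "0 < ?inf" if "l v = 0"
  proof -
    have "ereal r \<le> ereal (l u)" if "u \<in> verts (neighborhood T v)" for u
    proof -
      have u: "u \<in> pverts T" "(v, u) \<in> parcs T"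
        using that by (auto simp: neighborhood_def)
      then have "r \<le> max (l v) (l u)"
        using r(2)[of u] tree_dist_edge[of v u l] no_loops' by auto
      \<comment> \<open>Since \<open>r\<close> is positive, the bound by the maximum of 0 and
        \<open>l u\<close> must come from \<open>l u\<close>.\<close>
      with \<open>l v = 0\<close> r(1) show ?thesis by auto
    qed
    then have "ereal r \<le> ?inf" by (rule INF_greatest)
    with r(1) show ?thesis
      by (meson ereal_less(2) less_le_trans)
  qed
  then show "0 < l v \<or> (l v = 0 \<and> 0 < ?inf)"
    using assms by (auto simp: labeling_def less_le)
next
  assume "0 < l v \<or> (l v = 0 \<and> 0 < ?inf)"
  then show ?isolated
  proof
    assume "0 < l v"
    moreover have "l v \<le> tree_dist T l v u" if "u \<in> pverts T" "u \<noteq> v" for u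
      using joining_path_neighbor[of v u] label_le_tree_dist[of v u v l] that assms(2) by auto
    ultimately show ?isolated by blast
  next
    assume "l v = 0 \<and> 0 < ?inf"
    \<comment> \<open>A real number strictly below the infimum is chosen because the infimum is
      infinite when \<open>v\<close> has no neighbors.\<close>
    then obtain r where r: "0 < ereal r" "ereal r < ?inf"
      using ereal_dense2 by blast
    have "r \<le> tree_dist T l v u" if u: "u \<in> pverts T" "u \<noteq> v" for u
    proof -
      obtain w where w: "(v, w) \<in> parcs T" "{v, w} \<subseteq> set (joining_path T v u)"
        using joining_path_neighbor u assms(2) by blast
      then have "?inf \<le> ereal (l w)"
        by (intro INF_lower) (auto simp: neighborhood_def dest: in_arcsD2)
      with r(2) have "ereal r < ereal (l w)" by (rule less_le_trans)
      then show ?thesis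
        using label_le_tree_dist[of v u w l] w(2) u assms(2) by auto
    qed
    with r(1) show ?isolated by auto
  qed
qed

end

text \<open>A singleton is open exactly when some ball about its point contains no other point; this
  reduces discreteness to bounds on distances.\<close>

lemma (in Metric_space) discrete_metric_space_iff:
  "discrete_metric_space M d \<longleftrightarrow> (\<forall>x\<in>M. \<exists>r>0. \<forall>y\<in>M. y \<noteq> x \<longrightarrow> r \<le> d x y)"
proof -
  have "mball x r \<subseteq> {x} \<longleftrightarrow> (\<forall>y\<in>M. y \<noteq> x \<longrightarrow> r \<le> d x y)" if "x \<in> M" for x r
    using that by (auto simp: mball_def not_less[symmetric])
  then show ?thesis
    by (simp add: discrete_metric_space_def openin_mtopology)
qed

theorem theorem4p12:
  fixes T :: "'a pair_pre_digraph" and l :: "'a \<Rightarrow> real"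
  assumes "undirected_tree T"
    and "labeling T l"
    and "nondegenerate T l"
  shows "discrete_metric_space (pverts T) (tree_dist T l) \<longleftrightarrow>
    (\<forall>v\<in>pverts T. 0 < l v \<or>
       (l v = 0 \<and> 0 < (INF u\<in>verts (neighborhood T v). ereal (l u))))"
proof -
  interpret simple_tree T
    using assms(1) by (simp add: simple_tree_def simple_tree_axioms_def undirected_tree_def)
  interpret Metric_space "pverts T" "tree_dist T l"
    using assms(2,3) by (rule Metric_space_tree_dist)
  show ?thesis
    unfolding discrete_metric_space_iff using isolated_iff[OF assms(2)] by simp
qed

end
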